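(* Let $A,B$ be two invertible positive operators on a Hilbert space $\mathscr{H}$, let $\Phi$ be a normalized positive linear map on $\mathcal{B}(\mathscr{H})$, let $p\in(0,1]$, and put $r=\min\{p,1-p\}$ and $R=\max\{p,1-p\}$. Then $$\frac{2r}{p}\Big(\Phi(A\nabla B)-\Phi(A)\#\Phi(B)\Big)+T_p\big(\Phi(A)|\Phi(B)\big)\;\le\;\Phi(B-A)\;\le\;\frac{2R}{p}\Big(\Phi(A\nabla B)-\Phi(A\#B)\Big)+\Phi\big(T_p(A|B)\big).$$
   Context: $\mathcal{B}(\mathscr{H})$ is the algebra of bounded linear operators on the Hilbert space $\mathscr{H}$, $I$ is the identity operator, and $X\le Y$ denotes the usual (Loewner) order on self-adjoint operators, i.e. $Y-X$ is positive (positive semidefinite). A linear map $\Phi$ on $\mathcal{B}(\mathscr{H})$ is positive if it sends positive operators to positive operators, and normalized if $\Phi(I)=I$. For invertible positive operators $A,B$ and $p\in[0,1]$: $A\#_pB:=A^{\frac12}\left(A^{-\frac12}BA^{-\frac12}\right)^{p}A^{\frac12}$ and $A\nabla_pB:=(1-p)A+pB$; $\#$ and $\nabla$ without index mean $\#_{1/2}$ and $\nabla_{1/2}$. For $p\in(0,1]$, the Tsallis relative operator entropy is $T_p(A|B):=\dfrac{A\#_pB-A}{p}$. *)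

theory Defs
  imports "HOL-Analysis.Analysis" "HOL-Computational_Algebra.Polynomial"
begin

section \<open>Complex Hilbert spaces\<close>

class complex_vector = real_vector +
  fixes scaleC :: "complex \<Rightarrow> 'a \<Rightarrow> 'a"  (infixr \<open>*\<^sub>C\<close> 75)
  assumes scaleC_add_right: "c *\<^sub>C (x + y) = c *\<^sub>C x + c *\<^sub>C y"
    and scaleC_add_left: "(c + d) *\<^sub>C x = c *\<^sub>C x + d *\<^sub>C x"
    and scaleC_scaleC: "c *\<^sub>C d *\<^sub>C x = (c * d) *\<^sub>C x"
    and scaleR_scaleC: "r *\<^sub>R x = complex_of_real r *\<^sub>C x"

text \<open>
  The real inner product, and with it the norm and the topology, is that of the underlying real
  Hilbert space; positive definiteness of \<open>cinner\<close> and the identity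
  \<open>norm x = sqrt (Re (cinner x x))\<close> follow from \<open>inner_eq_Re_cinner\<close>.
  The form \<open>cinner\<close> is linear in its first and conjugate linear in its second argument.
\<close>

class complex_hilbert_space = real_inner + complete_space + complex_vector +
  fixes cinner :: "'a \<Rightarrow> 'a \<Rightarrow> complex"
  assumes cinner_commute: "cinner x y = cnj (cinner y x)"
    and cinner_add_left: "cinner (x + y) z = cinner x z + cinner y z"
    and cinner_scaleC_left: "cinner (c *\<^sub>C x) y = c * cinner x y"
    and inner_eq_Re_cinner: "inner x y = Re (cinner x y)"

instantiation complex :: complex_hilbert_space
begin
definition "scaleC_complex = ((*) :: complex \<Rightarrow> complex \<Rightarrow> complex)"
definition "cinner_complex x y = x * cnj y" for x y :: complex
instance
  by standard
    (auto simp: scaleC_complex_def cinner_complex_def algebra_simps scaleR_conv_of_real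
      inner_complex_def)
end

definition clinear :: "('a::complex_vector \<Rightarrow> 'b::complex_vector) \<Rightarrow> bool" where
  "clinear f \<longleftrightarrow> (\<forall>x y. f (x + y) = f x + f y) \<and> (\<forall>c x. f (c *\<^sub>C x) = c *\<^sub>C f x)"

lemma scaleC_one: "1 *\<^sub>C x = x" for x :: "'a::complex_vector"
  using scaleR_scaleC[of 1 x] by simp

lemma scaleC_zero_left: "0 *\<^sub>C x = 0" for x :: "'a::complex_vector"
  using scaleR_scaleC[of 0 x] by simp

lemma scaleC_zero_right: "c *\<^sub>C 0 = (0 :: 'a::complex_vector)"
  using scaleC_add_right[of c 0 "0::'a"] by simp

lemma scaleC_minus_right: "c *\<^sub>C (- x) = - (c *\<^sub>C x)" for x :: "'a::complex_vector"
  using scaleC_add_right[of c x "- x"] by (simp add: scaleC_zero_right eq_neg_iff_add_eq_0 add.commute)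

lemma scaleC_diff_right: "c *\<^sub>C (x - y) = c *\<^sub>C x - c *\<^sub>C y" for x :: "'a::complex_vector"
  using scaleC_add_right[of c x "- y"] by (simp add: scaleC_minus_right)

lemma scaleC_scaleR_commute: "c *\<^sub>C r *\<^sub>R x = r *\<^sub>R c *\<^sub>C x"
  for x :: "'a::complex_vector"
  by (simp only: scaleR_scaleC scaleC_scaleC mult.commute)

lemma norm_eq_sqrt_cinner: "norm x = sqrt (Re (cinner x x))" for x :: "'a::complex_hilbert_space"
  by (simp add: norm_eq_sqrt_inner inner_eq_Re_cinner)

lemma cinner_scaleC_right: "cinner x (c *\<^sub>C y) = cnj c * cinner x y"
  for x :: "'a::complex_hilbert_space"
  by (metis cinner_commute cinner_scaleC_left complex_cnj_mult)

lemma cinner_add_right: "cinner x (y + z) = cinner x y + cinner x z"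
  for x :: "'a::complex_hilbert_space"
  by (metis cinner_commute cinner_add_left complex_cnj_add)

lemma cinner_zero_left [simp]: "cinner 0 x = 0" for x :: "'a::complex_hilbert_space"
  using cinner_add_left[of 0 0 x] by simp

lemma cinner_minus_left: "cinner (- x) y = - cinner x y" for x :: "'a::complex_hilbert_space"
  using cinner_add_left[of x "- x" y] by (simp add: eq_neg_iff_add_eq_0 add.commute)

lemma cinner_diff_left: "cinner (x - y) z = cinner x z - cinner y z"
  for x :: "'a::complex_hilbert_space"
  using cinner_add_left[of x "- y" z] by (simp add: cinner_minus_left)

lemma norm_scaleC: "norm (c *\<^sub>C x) = cmod c * norm x" for x :: "'a::complex_hilbert_space"
proof -
  have "cinner (c *\<^sub>C x) (c *\<^sub>C x) = complex_of_real ((cmod c)\<^sup>2) * cinner x x"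
    by (simp only: cinner_scaleC_left cinner_scaleC_right complex_norm_square) (simp add: mult_ac)
  then show ?thesis
    by (simp add: norm_eq_sqrt_cinner[where ?'a = 'a] real_sqrt_mult)
qed

lemma bounded_linear_scaleC: "bounded_linear ((*\<^sub>C) c :: 'a::complex_hilbert_space \<Rightarrow> 'a)"
proof
  show "\<exists>K. \<forall>x::'a. norm (c *\<^sub>C x) \<le> norm x * K"
    by (rule exI[of _ "cmod c"]) (simp add: norm_scaleC)
qed (simp_all add: scaleC_add_right scaleC_scaleR_commute)

section \<open>Bounded operators\<close>

typedef (overloaded) 'a bop =
  "{f :: 'a::complex_hilbert_space \<Rightarrow> 'a. bounded_linear f \<and> clinear f}"
  morphisms bop_apply Bop
  by (rule exI[of _ "\<lambda>_. 0"]) (simp add: clinear_def scaleC_zero_right)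

setup_lifting type_definition_bop

instantiation bop :: (complex_hilbert_space) real_normed_vector
begin
lift_definition norm_bop :: "'a bop \<Rightarrow> real" is onorm .
lift_definition zero_bop :: "'a bop" is "\<lambda>_. 0"
  by (simp add: clinear_def scaleC_zero_right)
lift_definition plus_bop :: "'a bop \<Rightarrow> 'a bop \<Rightarrow> 'a bop" is "\<lambda>f g x. f x + g x"
  by (auto simp: clinear_def bounded_linear_add scaleC_add_right)
lift_definition uminus_bop :: "'a bop \<Rightarrow> 'a bop" is "\<lambda>f x. - f x"
  by (auto simp: clinear_def bounded_linear_minus scaleC_minus_right)
lift_definition minus_bop :: "'a bop \<Rightarrow> 'a bop \<Rightarrow> 'a bop" is "\<lambda>f g x. f x - g x"
  by (auto simp: clinear_def bounded_linear_sub scaleC_diff_right)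
lift_definition scaleR_bop :: "real \<Rightarrow> 'a bop \<Rightarrow> 'a bop" is "\<lambda>r f x. r *\<^sub>R f x"
  by (simp add: clinear_def scaleR_add_right scaleC_scaleR_commute bounded_linear_const_scaleR)
definition "dist_bop A B = norm (A - B)" for A B :: "'a bop"
definition "sgn_bop A = inverse (norm A) *\<^sub>R A" for A :: "'a bop"
definition "(uniformity :: ('a bop \<times> 'a bop) filter)
  = (INF e\<in>{0 <..}. principal {(x, y). dist x y < e})"
definition "open_bop (S :: 'a bop set)
  \<longleftrightarrow> (\<forall>x\<in>S. \<forall>\<^sub>F (x', y) in uniformity. x' = x \<longrightarrow> y \<in> S)"
instance
  apply standard
                 apply (unfold dist_bop_def open_bop_def sgn_bop_def uniformity_bop_def)
                 apply (rule refl | (transfer, force simp: onorm_eq_0 algebra_simps onorm_scaleR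
        onorm_triangle))+
  done
end

instantiation bop :: (complex_hilbert_space) complex_vector
begin
lift_definition scaleC_bop :: "complex \<Rightarrow> 'a bop \<Rightarrow> 'a bop" is "\<lambda>c f x. c *\<^sub>C f x"
  by (simp add: clinear_def scaleC_add_right scaleC_scaleC mult.commute
      bounded_linear_compose[OF bounded_linear_scaleC])
instance
  by standard
    (transfer, simp add: scaleC_add_right scaleC_add_left scaleC_scaleC scaleR_scaleC)+
end

text \<open>The product is composition.\<close>

instantiation bop :: (complex_hilbert_space) monoid_mult
begin
lift_definition one_bop :: "'a bop" is "\<lambda>x. x"
  by (simp add: clinear_def)
lift_definition times_bop :: "'a bop \<Rightarrow> 'a bop \<Rightarrow> 'a bop" is "\<lambda>f g x. f (g x)"
  by (simp add: clinear_def bounded_linear_compose)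
instance by standard (transfer, simp)+
end

definition pos_op :: "'a::complex_hilbert_space bop \<Rightarrow> bool" where
  "pos_op A \<longleftrightarrow> (\<forall>x. cinner (bop_apply A x) x \<in> \<real>\<^sub>\<ge>\<^sub>0)"

lemma bop_eq_zeroI:
  fixes A :: "'a::complex_hilbert_space bop"
  assumes "\<And>x. cinner (bop_apply A x) x = 0"
  shows "A = 0"
proof -
  have add: "bop_apply A (x + y) = bop_apply A x + bop_apply A y" for x y
    using bop_apply[of A] by (simp add: clinear_def)
  have sc: "bop_apply A (c *\<^sub>C x) = c *\<^sub>C bop_apply A x" for c x
    using bop_apply[of A] by (simp add: clinear_def)
  have 1: "cinner (bop_apply A x) y + cinner (bop_apply A y) x = 0" for x y
    using assms[of "x + y"] by (simp add: add cinner_add_left cinner_add_right assms add.commute)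
  have "cinner (bop_apply A x) y = 0" for x y
    using 1[of x y] 1[of "\<i> *\<^sub>C x" y]
    by (simp add: sc cinner_scaleC_left cinner_scaleC_right)
  then have "inner (bop_apply A x) (bop_apply A x) = 0" for x
    by (simp add: inner_eq_Re_cinner)
  then have "bop_apply A x = 0" for x by simp
  then show ?thesis by transfer auto
qed

text \<open>
  The Loewner order. On a complex Hilbert space an operator with \<open>pos_op A\<close> is
  automatically self-adjoint, so comparable operators differ by a self-adjoint one.
\<close>

instantiation bop :: (complex_hilbert_space) ordered_ab_group_add
begin
definition "less_eq_bop A B \<longleftrightarrow> pos_op (B - A)" for A B :: "'a bop"
definition "less_bop A B \<longleftrightarrow> A \<le> B \<and> \<not> B \<le> A" for A B :: "'a bop"
instance
proof
  fix A B C :: "'a bop"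
  show "A < B \<longleftrightarrow> A \<le> B \<and> \<not> B \<le> A" by (simp add: less_bop_def)
  show "A \<le> A" by (simp add: less_eq_bop_def pos_op_def zero_bop.rep_eq)
  show "A \<le> C" if "A \<le> B" "B \<le> C"
  proof -
    have "cinner (bop_apply (C - A) x) x
        = cinner (bop_apply (C - B) x) x + cinner (bop_apply (B - A) x) x" for x
      by (simp add: minus_bop.rep_eq flip: cinner_add_left)
    then show ?thesis using that
      by (simp add: less_eq_bop_def pos_op_def nonneg_Reals_add_I)
  qed
  show "A = B" if "A \<le> B" "B \<le> A"
  proof -
    have "cinner (bop_apply (A - B) x) x = 0" for x
    proof -
      have "cinner (bop_apply (B - A) x) x = - cinner (bop_apply (A - B) x) x"
        by (simp add: minus_bop.rep_eq flip: cinner_minus_left)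
      then show ?thesis using that
        by (auto simp: less_eq_bop_def pos_op_def complex_nonneg_Reals_iff complex_eq_iff
            intro: antisym dest!: spec[of _ x])
    qed
    then show ?thesis using bop_eq_zeroI[of "A - B"] by simp
  qed
  show "C + A \<le> C + B" if "A \<le> B" using that by (simp add: less_eq_bop_def)
qed
end

definition invertible_op :: "'a::complex_hilbert_space bop \<Rightarrow> bool" where
  "invertible_op A \<longleftrightarrow> (\<exists>B. A * B = 1 \<and> B * A = 1)"

definition positive_map ::
    "('a::complex_hilbert_space bop \<Rightarrow> 'b::complex_hilbert_space bop) \<Rightarrow> bool" where
  "positive_map \<Phi> \<longleftrightarrow> (\<forall>A. 0 \<le> A \<longrightarrow> 0 \<le> \<Phi> A)"

section \<open>Continuous functional calculus\<close>

definition op_spectrum :: "'a::complex_hilbert_space bop \<Rightarrow> complex set" where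
  "op_spectrum A = {z. \<not> invertible_op (z *\<^sub>C 1 - A)}"

definition poly_op :: "real poly \<Rightarrow> 'a::complex_hilbert_space bop \<Rightarrow> 'a bop" where
  "poly_op q A = (\<Sum>i\<le>degree q. coeff q i *\<^sub>R A ^ i)"

text \<open>
  For self-adjoint \<open>A\<close> (whose spectrum is a compact subset of the reals) and \<open>f\<close>
  continuous on it, \<open>f(A)\<close> is the norm limit of \<open>q\<^sub>n(A)\<close> for polynomials
  \<open>q\<^sub>n\<close> converging to \<open>f\<close> uniformly on the spectrum; the limit is required to be
  the same for all such sequences. Outside this situation the value is unspecified.
\<close>

definition fun_calc :: "(real \<Rightarrow> real) \<Rightarrow> 'a::complex_hilbert_space bop \<Rightarrow> 'a bop" where
  "fun_calc f A = (THE T. \<forall>q :: nat \<Rightarrow> real poly.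
     uniform_limit {t. complex_of_real t \<in> op_spectrum A} (\<lambda>n. poly (q n)) f sequentially
       \<longrightarrow> (\<lambda>n. poly_op (q n) A) \<longlonglongrightarrow> T)"

definition op_powr :: "'a::complex_hilbert_space bop \<Rightarrow> real \<Rightarrow> 'a bop" where
  "op_powr A p = fun_calc (\<lambda>t. t powr p) A"

section \<open>Operator means and relative entropy\<close>

definition geo_mean :: "real \<Rightarrow> 'a::complex_hilbert_space bop \<Rightarrow> 'a bop \<Rightarrow> 'a bop" where
  "geo_mean p A B =
     op_powr A (1/2) * op_powr (op_powr A (-1/2) * B * op_powr A (-1/2)) p * op_powr A (1/2)"

definition arith_mean :: "real \<Rightarrow> 'a::complex_hilbert_space bop \<Rightarrow> 'a bop \<Rightarrow> 'a bop" where
  "arith_mean p A B = (1 - p) *\<^sub>R A + p *\<^sub>R B"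

definition tsallis :: "real \<Rightarrow> 'a::complex_hilbert_space bop \<Rightarrow> 'a bop \<Rightarrow> 'a bop" where
  "tsallis p A B = (1 / p) *\<^sub>R (geo_mean p A B - A)"

end

theory Submission
  imports Defs "HOL-Computational_Algebra.Fundamental_Theorem_Algebra"
begin

text \<open>
  For \<open>t > 0\<close> the Kittaneh-Manasrah refinement of Young's inequality and its reverse read
  \<open>r (1 + t - 2 \<surd>t) \<le> (1 - p) + p t - t\<^sup>p \<le> R (1 + t - 2 \<surd>t)\<close>. Evaluating them by functional calculus at
  \<open>X = A\<^bsup>-1/2\<^esup> B A\<^bsup>-1/2\<^esup>\<close> and conjugating with \<open>A\<^bsup>1/2\<^esup>\<close> bounds \<open>A \<nabla>\<^sub>p B - A #\<^sub>p B\<close> between \<open>2 r\<close> and \<open>2 R\<close>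
  times \<open>A \<nabla> B - A # B\<close>. The left half of the theorem is the lower bound for \<open>\<Phi>(A), \<Phi>(B)\<close>, the right
  half is the image under \<open>\<Phi>\<close> of the upper bound for \<open>A, B\<close>, because
  \<open>A \<nabla>\<^sub>p B = A + p (B - A)\<close>.

  The functional calculus rests on \<open>\<parallel>q(A)\<parallel> \<le> sup \<bar>q\<bar>\<close> over the spectrum. By spectral mapping this reduces
  to the fact that the infimum of the numerical range of a self-adjoint operator is a spectral value.
\<close>

section \<open>Bounded operators as a Banach algebra\<close>

instance complex_hilbert_space \<subseteq> banach ..

lemma bounded_linear_bop_apply: "bounded_linear (bop_apply A)"
  using bop_apply[of A] by simp

lemmas bop_apply_add = linear_add[OF bounded_linear.linear[OF bounded_linear_bop_apply]]
  and bop_apply_diff = linear_diff[OF bounded_linear.linear[OF bounded_linear_bop_apply]]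
  and bop_apply_scaleR = linear_scale[OF bounded_linear.linear[OF bounded_linear_bop_apply]]

lemma bop_apply_scaleC: "bop_apply A (c *\<^sub>C x) = c *\<^sub>C bop_apply A x"
  using bop_apply[of A] by (simp add: clinear_def)

lemmas bop_apply_simps = plus_bop.rep_eq minus_bop.rep_eq uminus_bop.rep_eq zero_bop.rep_eq
  scaleR_bop.rep_eq scaleC_bop.rep_eq times_bop.rep_eq one_bop.rep_eq

lemma bop_eqI: "(\<And>x. bop_apply A x = bop_apply B x) \<Longrightarrow> A = B"
  by (metis bop_apply_inject ext)

lemma norm_bop_apply_le: "norm (bop_apply A x) \<le> norm A * norm x"
  unfolding norm_bop.rep_eq by (rule onorm[OF bounded_linear_bop_apply])

lemma norm_bop_le: "0 \<le> b \<Longrightarrow> (\<And>x. norm (bop_apply A x) \<le> b * norm x) \<Longrightarrow> norm A \<le> b"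
  unfolding norm_bop.rep_eq by (rule onorm_bound)

text \<open>This supplies continuity of the product for limits of operator polynomials. The class
  without unit is used because on the trivial space \<open>1 = 0\<close>, so that
  \<open>norm 1 = 1\<close> fails there.\<close>

instance bop :: (complex_hilbert_space) real_normed_algebra
proof
  fix A B C :: "'a bop" and r :: real
  show "(A + B) * C = A * C + B * C"
    by (rule bop_eqI) (simp add: bop_apply_simps)
  show "A * (B + C) = A * B + A * C"
    by (rule bop_eqI) (simp add: bop_apply_simps bop_apply_add)
  show "r *\<^sub>R A * B = r *\<^sub>R (A * B)"
    by (rule bop_eqI) (simp add: bop_apply_simps)
  show "A * r *\<^sub>R B = r *\<^sub>R (A * B)"
    by (rule bop_eqI) (simp add: bop_apply_simps bop_apply_scaleR)
  show "norm (A * B) \<le> norm A * norm B"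
  proof (rule norm_bop_le)
    show "norm (bop_apply (A * B) x) \<le> norm A * norm B * norm x" for x
      using order_trans[OF norm_bop_apply_le mult_left_mono[OF norm_bop_apply_le norm_ge_zero]]
      by (simp add: bop_apply_simps mult.assoc)
  qed simp
qed

text \<open>Completeness is inherited from the real bounded linear maps: the limit found there is a
  pointwise limit of complex linear maps, hence complex linear.\<close>

instance bop :: (complex_hilbert_space) banach
proof
  fix X :: "nat \<Rightarrow> 'a bop"
  assume "Cauchy X"
  define F where "F n = Blinfun (bop_apply (X n))" for n
  have F: "blinfun_apply (F n) = bop_apply (X n)" for n
    by (simp add: F_def bounded_linear_Blinfun_apply[OF bounded_linear_bop_apply])
  have "dist (F m) (F n) = dist (X m) (X n)" for m n
    unfolding dist_norm norm_bop.rep_eq norm_blinfun.rep_eq minus_bop.rep_eq minus_blinfun.rep_eq F ..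
  with \<open>Cauchy X\<close> have "Cauchy F"
    by (simp add: Cauchy_def)
  then obtain L where L: "F \<longlonglongrightarrow> L"
    using Cauchy_convergent_iff convergent_def by blast
  have lim: "(\<lambda>n. bop_apply (X n) x) \<longlonglongrightarrow> blinfun_apply L x" for x
    using blinfun.tendsto[OF L tendsto_const, of x] by (simp add: F)
  have sc: "blinfun_apply L (c *\<^sub>C x) = c *\<^sub>C blinfun_apply L x" for c x
  proof (rule LIMSEQ_unique[OF lim])
    show "(\<lambda>n. bop_apply (X n) (c *\<^sub>C x)) \<longlonglongrightarrow> c *\<^sub>C blinfun_apply L x"
      unfolding bop_apply_scaleC by (rule bounded_linear.tendsto[OF bounded_linear_scaleC lim])
  qed
  have T: "bop_apply (Bop (blinfun_apply L)) = blinfun_apply L"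
    by (rule Bop_inverse) (simp add: blinfun.bounded_linear_right clinear_def blinfun.add_right sc)
  have "dist (X n) (Bop (blinfun_apply L)) = dist (F n) L" for n
    unfolding dist_norm norm_bop.rep_eq norm_blinfun.rep_eq minus_bop.rep_eq minus_blinfun.rep_eq F T ..
  with L have "X \<longlonglongrightarrow> Bop (blinfun_apply L)"
    by (simp add: tendsto_dist_iff[of X] tendsto_dist_iff[of F])
  then show "convergent X"
    by (rule convergentI)
qed

section \<open>Self-adjoint and positive operators\<close>

text \<open>Symmetry for the real inner product is enough: since operators are complex linear,
  replacing \<open>x\<close> by \<open>\<i> *\<^sub>C x\<close> yields the imaginary part.\<close>

definition self_adjoint :: "'a::complex_hilbert_space bop \<Rightarrow> bool" where
  "self_adjoint A \<longleftrightarrow> (\<forall>x y. inner (bop_apply A x) y = inner x (bop_apply A y))"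

lemma self_adjointD: "self_adjoint A \<Longrightarrow> inner (bop_apply A x) y = inner x (bop_apply A y)"
  by (simp add: self_adjoint_def)

lemma self_adjoint_0 [simp]: "self_adjoint 0"
  and self_adjoint_1 [simp]: "self_adjoint 1"
  and self_adjoint_add: "self_adjoint A \<Longrightarrow> self_adjoint B \<Longrightarrow> self_adjoint (A + B)"
  and self_adjoint_diff: "self_adjoint A \<Longrightarrow> self_adjoint B \<Longrightarrow> self_adjoint (A - B)"
  and self_adjoint_scaleR: "self_adjoint A \<Longrightarrow> self_adjoint (r *\<^sub>R A)"
  by (simp_all add: self_adjoint_def bop_apply_simps inner_add_left inner_add_right
      inner_diff_left inner_diff_right)

lemma self_adjoint_mult:
  "self_adjoint A \<Longrightarrow> self_adjoint B \<Longrightarrow> A * B = B * A \<Longrightarrow> self_adjoint (A * B)"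
  unfolding self_adjoint_def by (metis times_bop.rep_eq)

lemma self_adjoint_conj:
  "self_adjoint G \<Longrightarrow> self_adjoint A \<Longrightarrow> self_adjoint (G * A * G)"
  unfolding self_adjoint_def by (simp add: times_bop.rep_eq)

lemma pos_op_iff:
  "pos_op A \<longleftrightarrow> self_adjoint A \<and> (\<forall>x. 0 \<le> inner (bop_apply A x) x)"
proof
  assume pos: "pos_op A"
  \<comment> \<open>The defect of symmetry is sesquilinear and vanishes on the diagonal because the
    form of \<open>A\<close> is real. Polarizing at \<open>x + y\<close> makes it antisymmetric,
    polarizing with \<open>\<i> *\<^sub>C x\<close> makes it symmetric, so it is zero.\<close>
  define D where "D x y = cinner (bop_apply A x) y - cinner x (bop_apply A y)" for x y
  have D0: "D x x = 0" for x
  proof -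
    have "cinner (bop_apply A x) x = cnj (cinner (bop_apply A x) x)"
      using pos unfolding pos_op_def by (simp add: complex_nonneg_Reals_iff complex_eq_iff)
    then show ?thesis
      unfolding D_def by (subst (2) cinner_commute) simp
  qed
  have D1: "D x y + D y x = 0" for x y
    using D0[of "x + y"] D0[of x] D0[of y]
    by (simp add: D_def bop_apply_add cinner_add_left cinner_add_right algebra_simps)
  have "D x y = 0" for x y
  proof -
    have "\<i> * (D x y - D y x) = 0"
      using D1[of "\<i> *\<^sub>C x" y]
      by (simp add: D_def bop_apply_scaleC cinner_scaleC_left cinner_scaleC_right algebra_simps)
    with D1[of x y] show ?thesis by simp
  qed
  then have "self_adjoint A"
    by (simp add: self_adjoint_def inner_eq_Re_cinner D_def)
  with pos show "self_adjoint A \<and> (\<forall>x. 0 \<le> inner (bop_apply A x) x)"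
    by (simp add: pos_op_def inner_eq_Re_cinner complex_nonneg_Reals_iff)
next
  assume A: "self_adjoint A \<and> (\<forall>x. 0 \<le> inner (bop_apply A x) x)"
  have "Im (cinner (bop_apply A x) x) = 0" for x
  proof -
    have "inner (bop_apply A (\<i> *\<^sub>C x)) x = inner (\<i> *\<^sub>C x) (bop_apply A x)"
      using A by (simp add: self_adjointD)
    then have "Im (cinner (bop_apply A x) x) = Im (cinner x (bop_apply A x))"
      by (simp add: inner_eq_Re_cinner bop_apply_scaleC cinner_scaleC_left)
    also have "\<dots> = - Im (cinner (bop_apply A x) x)"
      by (subst cinner_commute) simp
    finally show ?thesis by simp
  qed
  with A show "pos_op A"
    by (simp add: pos_op_def inner_eq_Re_cinner complex_nonneg_Reals_iff)
qed

lemma nonneg_bop_iff: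
  "0 \<le> A \<longleftrightarrow> self_adjoint A \<and> (\<forall>x. 0 \<le> inner (bop_apply A x) x)"
  by (simp add: less_eq_bop_def pos_op_iff)

lemma le_bop_iff:
  assumes "self_adjoint A" "self_adjoint B"
  shows "A \<le> B \<longleftrightarrow> (\<forall>x. inner (bop_apply A x) x \<le> inner (bop_apply B x) x)"
  using assms by (simp add: less_eq_bop_def pos_op_iff self_adjoint_diff bop_apply_simps inner_diff_left)

lemma scaleR_one_le_bop_iff:
  assumes "self_adjoint A"
  shows "c *\<^sub>R 1 \<le> A \<longleftrightarrow> (\<forall>x. c * (norm x)\<^sup>2 \<le> inner (bop_apply A x) x)"
  using assms
  by (simp add: le_bop_iff self_adjoint_scaleR bop_apply_simps power2_norm_eq_inner)

lemma bop_le_scaleR_one_iff: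
  assumes "self_adjoint A"
  shows "A \<le> c *\<^sub>R 1 \<longleftrightarrow> (\<forall>x. inner (bop_apply A x) x \<le> c * (norm x)\<^sup>2)"
  using assms
  by (simp add: le_bop_iff self_adjoint_scaleR bop_apply_simps power2_norm_eq_inner)

lemma bop_le_norm:
  assumes "self_adjoint A"
  shows "A \<le> norm A *\<^sub>R 1" "- norm A *\<^sub>R 1 \<le> A"
proof -
  have "\<bar>inner (bop_apply A x) x\<bar> \<le> norm A * (norm x)\<^sup>2" for x
    using order_trans[OF Cauchy_Schwarz_ineq2 mult_right_mono[OF norm_bop_apply_le norm_ge_zero]]
    by (simp add: power2_eq_square mult.assoc)
  then show "A \<le> norm A *\<^sub>R 1" "- norm A *\<^sub>R 1 \<le> A"
    using assms by (auto simp: bop_le_scaleR_one_iff scaleR_one_le_bop_iff abs_le_iff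
        intro: minus_le_iff[THEN iffD1] simp del: scaleR_minus_left)
qed

lemma nonneg_scaleR_bop: "0 \<le> r \<Longrightarrow> 0 \<le> A \<Longrightarrow> 0 \<le> r *\<^sub>R A" for A :: "'a::complex_hilbert_space bop"
  by (simp add: nonneg_bop_iff self_adjoint_scaleR bop_apply_simps)

lemma scaleR_mono_bop:
  fixes A :: "'a::complex_hilbert_space bop"
  assumes "0 \<le> r" "A \<le> B"
  shows "r *\<^sub>R A \<le> r *\<^sub>R B"
  using nonneg_scaleR_bop[of r "B - A"] assms by (simp add: scaleR_diff_right)

lemma nonneg_conj: "self_adjoint G \<Longrightarrow> 0 \<le> A \<Longrightarrow> 0 \<le> G * A * G"
  by (simp add: nonneg_bop_iff self_adjoint_conj times_bop.rep_eq self_adjointD[of G])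

lemma conj_mono:
  assumes "self_adjoint G" "A \<le> B"
  shows "G * A * G \<le> G * B * G"
  using nonneg_conj[of G "B - A"] assms by (simp add: algebra_simps)

text \<open>Polarization writes \<open>4 * inner (bop_apply A x) y\<close> as a difference of
  quadratic forms at \<open>x + y\<close> and \<open>x - y\<close>; the parallelogram law then turns
  the form bound into a bound on the bilinear form.\<close>

lemma norm_self_adjoint_le:
  assumes sa: "self_adjoint A" and "- c *\<^sub>R 1 \<le> A" "A \<le> c *\<^sub>R 1" and c: "0 \<le> c"
  shows "norm A \<le> c"
proof (rule norm_bop_le[OF c])
  fix x
  let ?q = "\<lambda>x. inner (bop_apply A x) x"
  have q: "\<bar>?q x\<bar> \<le> c * (norm x)\<^sup>2" for x
    using assms(2,3) scaleR_one_le_bop_iff[OF sa, of "- c"] bop_le_scaleR_one_iff[OF sa, of c]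
    by (simp add: abs_le_iff) (metis minus_le_iff)
  have main: "2 * inner (bop_apply A x) y \<le> c * ((norm x)\<^sup>2 + (norm y)\<^sup>2)" for x y
  proof -
    have "4 * inner (bop_apply A x) y = ?q (x + y) - ?q (x - y)"
      using self_adjointD[OF sa, of x y]
      by (simp add: bop_apply_add bop_apply_diff inner_add_left inner_add_right inner_diff_left
          inner_diff_right inner_commute)
    also have "\<dots> \<le> c * (norm (x + y))\<^sup>2 + c * (norm (x - y))\<^sup>2"
      using q[of "x + y"] q[of "x - y"] by linarith
    also have "\<dots> = 2 * c * ((norm x)\<^sup>2 + (norm y)\<^sup>2)"
      by (simp add: power2_norm_eq_inner inner_add_left inner_add_right inner_diff_left
          inner_diff_right inner_commute algebra_simps)
    finally show ?thesis by simp
  qed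
  show "norm (bop_apply A x) \<le> c * norm x"
  proof (cases "bop_apply A x = 0")
    case False
    \<comment> \<open>\<open>A x\<close> rescaled to the length of \<open>x\<close>: both squares on
      the right of \<open>main\<close> become equal, and the left side becomes
      \<open>2 * norm x * norm (bop_apply A x)\<close>.\<close>
    define y where "y = (norm x / norm (bop_apply A x)) *\<^sub>R bop_apply A x"
    have "inner (bop_apply A x) y = norm x * norm (bop_apply A x)" "norm y = norm x"
      using False by (simp_all add: y_def dot_square_norm power2_eq_square)
    with main[of x y] have "norm x * norm (bop_apply A x) \<le> norm x * (c * norm x)"
      by (simp add: power2_eq_square mult.left_commute)
    moreover have "0 < norm x"
      using False bop_apply_scaleR[of A 0 x] by auto
    ultimately show ?thesis by simp
  qed (simp add: c)
qed

text \<open>Norm convergence gives pointwise convergence, and both symmetry and nonnegativity of the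
  form are closed conditions.\<close>

lemma nonneg_bop_limit:
  fixes X :: "nat \<Rightarrow> 'a::complex_hilbert_space bop"
  assumes lim: "X \<longlonglongrightarrow> T" and X: "\<And>n. 0 \<le> X n"
  shows "0 \<le> T"
proof -
  have lim_apply: "(\<lambda>n. bop_apply (X n) x) \<longlonglongrightarrow> bop_apply T x" for x
  proof -
    have "bounded_linear (\<lambda>A. bop_apply A x)"
      by (rule bounded_linear_intro[where K = "norm x"])
        (simp_all add: bop_apply_simps norm_bop_apply_le)
    then show ?thesis by (rule bounded_linear.tendsto[OF _ lim])
  qed
  have "self_adjoint T"
    unfolding self_adjoint_def
  proof (intro allI)
    fix x y
    have eq: "inner (bop_apply (X n) x) y = inner x (bop_apply (X n) y)" for n
      using X[of n] by (simp add: nonneg_bop_iff self_adjointD)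
    show "inner (bop_apply T x) y = inner x (bop_apply T y)"
      using tendsto_inner[OF lim_apply[of x] tendsto_const[of y]]
        tendsto_inner[OF tendsto_const[of x] lim_apply[of y]]
      unfolding eq by (rule LIMSEQ_unique)
  qed
  moreover have "0 \<le> inner (bop_apply T x) x" for x
    by (rule LIMSEQ_le_const[OF tendsto_inner[OF lim_apply[of x] tendsto_const[of x]]])
      (use X in \<open>simp add: nonneg_bop_iff\<close>)
  ultimately show ?thesis
    by (simp add: nonneg_bop_iff)
qed

section \<open>Invertibility\<close>

lemma invertible_op_mult: "invertible_op A \<Longrightarrow> invertible_op B \<Longrightarrow> invertible_op (A * B)"
  unfolding invertible_op_def by (metis mult.assoc mult_1_left)

lemma invertible_op_1 [simp]: "invertible_op 1"
  unfolding invertible_op_def by (metis mult_1_left)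

lemma invertible_op_scaleR:
  assumes "invertible_op A" "r \<noteq> 0"
  shows "invertible_op (r *\<^sub>R A)"
proof -
  obtain B where "A * B = 1" "B * A = 1"
    using assms by (auto simp: invertible_op_def)
  with assms(2) show ?thesis
    unfolding invertible_op_def by (intro exI[of _ "inverse r *\<^sub>R B"]) simp
qed

text \<open>Lax-Milgram by Banach's fixed point theorem: solutions of \<open>A x = y\<close> are the
  fixed points of \<open>x - t (A x - y)\<close>. Coercivity also bounds the inverse by
  \<open>1 / c\<close>.\<close>

lemma invertible_op_coercive:
  fixes A :: "'a::complex_hilbert_space bop"
  assumes c: "0 < c" and coer: "\<And>x. c * (norm x)\<^sup>2 \<le> inner (bop_apply A x) x"
  shows "invertible_op A"
proof -
  \<comment> \<open>\<open>t\<close> minimizes \<open>1 - 2 t c + t^2 M^2\<close>, with minimum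
    \<open>k^2\<close>. Adding \<open>c\<close> to the norm gives \<open>0 < M\<close> and
    \<open>c \<le> M\<close> even on the trivial space.\<close>
  define M where "M = norm A + c"
  define t where "t = c / M\<^sup>2"
  define k where "k = sqrt (1 - c\<^sup>2 / M\<^sup>2)"
  have M: "c \<le> M" "0 < M" using c by (auto simp: M_def add_nonneg_pos)
  have k2: "0 \<le> 1 - c\<^sup>2 / M\<^sup>2" "1 - c\<^sup>2 / M\<^sup>2 < 1"
    using M c by (auto simp: divide_simps)
  have k: "0 \<le> k" "k < 1"
    using k2 by (auto simp: k_def)
  have t: "0 < t" using M c by (auto simp: t_def)
  have contr: "norm (x - t *\<^sub>R bop_apply A x) \<le> k * norm x" for x
  proof (rule power2_le_imp_le)
    have nA: "norm (bop_apply A x) \<le> M * norm x"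
      using norm_bop_apply_le[of A x] c by (simp add: M_def distrib_right add_increasing2)
    have "(norm (x - t *\<^sub>R bop_apply A x))\<^sup>2
        = (norm x)\<^sup>2 - 2 * t * inner (bop_apply A x) x + t\<^sup>2 * (norm (bop_apply A x))\<^sup>2"
      unfolding power2_norm_eq_inner power2_eq_square[of t]
      by (simp add: inner_diff_left inner_diff_right inner_commute algebra_simps)
    also have "\<dots> \<le> (norm x)\<^sup>2 - 2 * t * (c * (norm x)\<^sup>2) + t\<^sup>2 * (M * norm x)\<^sup>2"
      using coer[of x] nA t by (intro add_mono diff_mono mult_left_mono power_mono) auto
    also have "\<dots> = (1 - c\<^sup>2 / M\<^sup>2) * (norm x)\<^sup>2"
      using M by (simp add: t_def field_simps power2_eq_square)
    also have "\<dots> = (k * norm x)\<^sup>2"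
      using k2 by (simp add: k_def power_mult_distrib)
    finally show "(norm (x - t *\<^sub>R bop_apply A x))\<^sup>2 \<le> (k * norm x)\<^sup>2" .
  qed (use k in simp)
  have ex1: "\<exists>!x. bop_apply A x = y" for y
  proof -
    let ?f = "\<lambda>x. x - t *\<^sub>R (bop_apply A x - y)"
    have "dist (?f u) (?f v) \<le> k * dist u v" for u v
      using contr[of "u - v"] by (simp add: dist_norm bop_apply_diff algebra_simps)
    then have "\<exists>!x. ?f x = x"
      using banach_fix_type[OF k, of ?f] by blast
    then show ?thesis using t by simp
  qed
  define g where "g y = (THE x. bop_apply A x = y)" for y
  have Ag: "bop_apply A (g y) = y" for y
    unfolding g_def by (rule theI'[OF ex1])
  have gA: "g (bop_apply A x) = x" for x
    using ex1 Ag by metis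
  have g_add: "g (x + y) = g x + g y" for x y
    by (metis Ag gA bop_apply_add)
  have g_sc: "g (a *\<^sub>C x) = a *\<^sub>C g x" for a x
    by (metis Ag gA bop_apply_scaleC)
  have g_bd: "norm (g y) \<le> norm y * inverse c" for y
  proof (cases "g y = 0")
    case False
    have "c * (norm (g y))\<^sup>2 \<le> norm y * norm (g y)"
      using order_trans[OF coer[of "g y"] norm_cauchy_schwarz] by (simp add: Ag)
    then have "c * norm (g y) \<le> norm y"
      using False by (simp add: power2_eq_square flip: mult.assoc)
    then show ?thesis using c by (simp add: field_simps)
  qed (use c in simp)
  have "bounded_linear g"
    by (rule bounded_linear_intro[OF _ _ g_bd]) (simp_all add: g_add scaleR_scaleC g_sc)
  then have "bop_apply (Bop g) = g"
    by (intro Bop_inverse) (simp add: clinear_def g_add g_sc)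
  then show ?thesis
    unfolding invertible_op_def
    by (intro exI[of _ "Bop g"] conjI bop_eqI) (simp_all add: bop_apply_simps Ag gA)
qed

lemma invertible_op_scaleR_one_le:
  assumes "0 < c" "c *\<^sub>R 1 \<le> A"
  shows "invertible_op A"
proof (rule invertible_op_coercive[OF assms(1)])
  \<comment> \<open>\<open>A - c\<close> is positive, hence self-adjoint; adding \<open>c\<close>
    back gives self-adjointness of \<open>A\<close>.\<close>
  have "self_adjoint (A - c *\<^sub>R 1 + c *\<^sub>R 1)"
    using assms by (intro self_adjoint_add self_adjoint_scaleR) (auto simp: less_eq_bop_def pos_op_iff)
  with assms show "c * (norm x)\<^sup>2 \<le> inner (bop_apply A x) x" for x
    by (simp add: scaleR_one_le_bop_iff)
qed

text \<open>
  If \<open>A\<close> is positive, then \<open>\<parallel>A x\<parallel>\<^sup>2 \<le> K \<langle>A x, x\<rangle>\<close> with \<open>K = \<parallel>A\<parallel> + 1\<close>: evaluate the form of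
  \<open>A\<close> at \<open>x - K\<^sup>-\<^sup>1 A x\<close>.
\<close>

lemma nonneg_invertible_coercive:
  fixes A :: "'a::complex_hilbert_space bop"
  assumes pos: "0 \<le> A" and inv: "invertible_op A"
  obtains c where "0 < c" "c *\<^sub>R 1 \<le> A"
proof -
  obtain B where B: "B * A = 1"
    using inv by (auto simp: invertible_op_def)
  have sa: "self_adjoint A" and pos': "\<And>x. 0 \<le> inner (bop_apply A x) x"
    using pos by (auto simp: nonneg_bop_iff)
  define K where "K = norm A + 1"
  \<comment> \<open>The left inverse \<open>B\<close> gives
    \<open>norm x \<le> L * norm (A x)\<close>; with \<open>quad\<close> this makes \<open>A\<close>
    coercive with constant \<open>1 / (L^2 K)\<close>. The summand 1 keeps \<open>L\<close>
    positive.\<close>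
  define L where "L = norm B + 1"
  have KL: "0 < K" "0 < L" by (auto simp: K_def L_def add_nonneg_pos)
  have quad: "(norm (bop_apply A x))\<^sup>2 \<le> K * inner (bop_apply A x) x" for x
  proof -
    let ?y = "bop_apply A x"
    have "inner (bop_apply A ?y) ?y \<le> norm A * (norm ?y)\<^sup>2"
      using bop_le_norm(1)[OF sa] by (simp add: bop_le_scaleR_one_iff[OF sa])
    also have "\<dots> \<le> K * (norm ?y)\<^sup>2"
      by (intro mult_right_mono) (auto simp: K_def)
    finally have 1: "inner (bop_apply A ?y) ?y \<le> K * (norm ?y)\<^sup>2" .
    have "0 \<le> inner (bop_apply A (K *\<^sub>R x - ?y)) (K *\<^sub>R x - ?y)"
      by (rule pos')
    also have "\<dots> = K\<^sup>2 * inner ?y x - 2 * K * (norm ?y)\<^sup>2 + inner (bop_apply A ?y) ?y"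
      using self_adjointD[OF sa, of ?y x]
      by (simp add: bop_apply_diff bop_apply_scaleR inner_diff_left inner_diff_right
          dot_square_norm power2_eq_square algebra_simps inner_commute)
    also have "\<dots> \<le> K * (K * inner ?y x - (norm ?y)\<^sup>2)"
      using 1 by (simp add: power2_eq_square algebra_simps)
    finally show ?thesis
      using KL by (simp add: zero_le_mult_iff)
  qed
  have lower: "1 / (L\<^sup>2 * K) * (norm x)\<^sup>2 \<le> inner (bop_apply A x) x" for x
  proof -
    have "norm x = norm (bop_apply B (bop_apply A x))"
      using B by (metis one_bop.rep_eq times_bop.rep_eq)
    also have "\<dots> \<le> L * norm (bop_apply A x)"
      using norm_bop_apply_le[of B "bop_apply A x"] by (simp add: L_def distrib_right add_increasing2)
    finally have "(norm x)\<^sup>2 \<le> L\<^sup>2 * (norm (bop_apply A x))\<^sup>2"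
      by (metis norm_ge_zero power_mono power_mult_distrib)
    also have "\<dots> \<le> L\<^sup>2 * (K * inner (bop_apply A x) x)"
      by (intro mult_left_mono quad) simp
    finally show ?thesis
      using KL by (simp add: field_simps)
  qed
  show ?thesis
    by (rule that[of "1 / (L\<^sup>2 * K)"]) (use KL lower sa in \<open>auto simp: scaleR_one_le_bop_iff\<close>)
qed

section \<open>Polynomials of an operator\<close>

lemma poly_op_0 [simp]: "poly_op 0 A = 0"
  by (simp add: poly_op_def)

text \<open>Horner's rule, the form in which the inductions over polynomials use
  \<open>poly_op\<close>. For \<open>q = 0\<close> the degree does not rise, so this case is split
  off before shifting the sum.\<close>

lemma poly_op_pCons: "poly_op (pCons a q) A = a *\<^sub>R 1 + A * poly_op q A"
proof (cases "q = 0")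
  case False
  then show ?thesis
    by (simp add: poly_op_def sum.atMost_Suc_shift sum_distrib_left del: sum.atMost_Suc)
qed (simp add: poly_op_def)

lemma poly_op_smult: "poly_op (smult c q) A = c *\<^sub>R poly_op q A"
  by (induction q) (simp_all add: poly_op_pCons scaleR_add_right)

lemma poly_op_add: "poly_op (q1 + q2) A = poly_op q1 A + poly_op q2 A"
  by (induction q1 q2 rule: poly_induct2)
    (simp_all add: poly_op_pCons scaleR_add_left distrib_left)

lemma poly_op_diff: "poly_op (q1 - q2) A = poly_op q1 A - poly_op q2 A"
  using poly_op_add[of "q1 - q2" q2 A] by simp

lemma poly_op_mult: "poly_op (q1 * q2) A = poly_op q1 A * poly_op q2 A"
  by (induction q1) (simp_all add: poly_op_pCons poly_op_add poly_op_smult distrib_right mult.assoc)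

lemma self_adjoint_poly_op:
  assumes "self_adjoint A"
  shows "self_adjoint (poly_op q A)"
proof (induction q)
  case (pCons a q)
  have "A * poly_op q A = poly_op q A * A"
    using poly_op_mult[of "[:0, 1:]" q A] poly_op_mult[of q "[:0, 1:]" A]
    by (simp add: poly_op_pCons mult.commute[of q])
  with pCons assms show ?case
    by (simp add: poly_op_pCons self_adjoint_add self_adjoint_scaleR self_adjoint_mult)
qed simp

section \<open>The spectrum of a self-adjoint operator\<close>

text \<open>This is literally the set on which \<open>fun_calc\<close> asks for uniform
  convergence.\<close>

definition real_spectrum :: "'a::complex_hilbert_space bop \<Rightarrow> real set" where
  "real_spectrum A = {t. complex_of_real t \<in> op_spectrum A}"

lemma real_spectrum_iff: "t \<in> real_spectrum A \<longleftrightarrow> \<not> invertible_op (A - t *\<^sub>R 1)"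
proof -
  have "A - t *\<^sub>R 1 = (-1) *\<^sub>R (complex_of_real t *\<^sub>C 1 - A)"
    by (simp flip: scaleR_scaleC)
  moreover have "complex_of_real t *\<^sub>C 1 - A = (-1) *\<^sub>R (A - t *\<^sub>R 1)"
    by (simp flip: scaleR_scaleC)
  ultimately show ?thesis
    unfolding real_spectrum_def op_spectrum_def
    by (metis invertible_op_scaleR mem_Collect_eq neg_equal_0_iff_equal one_neq_zero)
qed

text \<open>For \<open>t\<close> outside the interval, \<open>A - t\<close> or \<open>t - A\<close>
  dominates a positive multiple of the identity and is therefore invertible.\<close>

lemma real_spectrum_subset:
  assumes "a *\<^sub>R 1 \<le> A" "A \<le> b *\<^sub>R 1"
  shows "real_spectrum A \<subseteq> {a..b}"
proof
  fix t assume t: "t \<in> real_spectrum A"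
  have "a \<le> t"
  proof (rule ccontr)
    assume "\<not> a \<le> t"
    moreover have "(a - t) *\<^sub>R 1 \<le> A - t *\<^sub>R 1"
      using assms(1) by (simp add: scaleR_diff_left)
    ultimately have "invertible_op (A - t *\<^sub>R 1)"
      by (intro invertible_op_scaleR_one_le[of "a - t"]) auto
    with t show False by (simp add: real_spectrum_iff)
  qed
  moreover have "t \<le> b"
  proof (rule ccontr)
    assume "\<not> t \<le> b"
    moreover have "(t - b) *\<^sub>R 1 \<le> t *\<^sub>R 1 - A"
      using assms(2) by (simp add: scaleR_diff_left)
    ultimately have "invertible_op (t *\<^sub>R 1 - A)"
      by (intro invertible_op_scaleR_one_le[of "t - b"]) auto
    then have "invertible_op ((-1) *\<^sub>R (t *\<^sub>R 1 - A))"
      by (rule invertible_op_scaleR) simp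
    with t show False by (simp add: real_spectrum_iff)
  qed
  ultimately show "t \<in> {a..b}" by simp
qed

text \<open>Take \<open>m\<close> as the largest lower bound of \<open>A\<close>. If the positive
  operator \<open>A - m\<close> were invertible, it would dominate some \<open>c > 0\<close>, and
  \<open>m + c\<close> would be a larger lower bound.\<close>

lemma real_spectrum_lower_bound:
  fixes A :: "'a::complex_hilbert_space bop"
  assumes sa: "self_adjoint A" and nontriv: "(x0 :: 'a) \<noteq> 0"
  obtains m where "m \<in> real_spectrum A" "m *\<^sub>R 1 \<le> A"
proof -
  define N where "N = {c. c *\<^sub>R 1 \<le> A}"
  have mono: "inner (bop_apply A x) x \<ge> c * (norm x)\<^sup>2" if "c \<in> N" for c x
    using that by (simp add: N_def scaleR_one_le_bop_iff[OF sa])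
  \<comment> \<open>The Rayleigh quotient at \<open>x0\<close> bounds all of \<open>N\<close>; this
    is where a nonzero vector is required.\<close>
  define u where "u = inner (bop_apply A x0) x0 / (norm x0)\<^sup>2"
  have bdd: "c \<le> u" if "c \<in> N" for c
    using mono[OF that, of x0] nontriv by (simp add: u_def field_simps)
  then have bdd': "bdd_above N"
    by (auto simp: bdd_above_def)
  have ne: "N \<noteq> {}"
    using bop_le_norm(2)[OF sa] by (auto simp: N_def simp del: scaleR_minus_left)
  define m where "m = Sup N"
  have "m * (norm x)\<^sup>2 \<le> inner (bop_apply A x) x" for x
  proof (cases "x = 0")
    case False
    have "m \<le> inner (bop_apply A x) x / (norm x)\<^sup>2"
      unfolding m_def using mono[of _ x] False by (intro cSup_least[OF ne]) (simp add: field_simps)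
    with False show ?thesis by (simp add: field_simps)
  qed (simp add: bop_apply_scaleR[of A 0 0, simplified])
  then have m: "m *\<^sub>R 1 \<le> A"
    by (simp add: scaleR_one_le_bop_iff[OF sa])
  have "m \<in> real_spectrum A"
    unfolding real_spectrum_iff
  proof
    assume "invertible_op (A - m *\<^sub>R 1)"
    with m obtain c where c: "0 < c" "c *\<^sub>R 1 \<le> A - m *\<^sub>R 1"
      using nonneg_invertible_coercive[of "A - m *\<^sub>R 1"] by auto
    then have "m + c \<in> N"
      by (simp add: N_def scaleR_add_left le_diff_eq add.commute)
    then have "m + c \<le> m"
      unfolding m_def using bdd' by (rule cSup_upper)
    with c show False by simp
  qed
  with m show ?thesis by (rule that[rotated])
qed

lemma poly_map_of_real:
  "poly (map_poly of_real q) (of_real t) = (of_real (poly q t) :: complex)"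
  by (induction q) (simp_all add: map_poly_pCons)

lemma map_poly_of_real_add:
  "map_poly complex_of_real (q1 + q2) = map_poly of_real q1 + map_poly of_real q2"
  by (rule poly_eqI) (simp add: coeff_map_poly)

lemma map_poly_of_real_mult:
  "map_poly complex_of_real (q1 * q2) = map_poly of_real q1 * map_poly of_real q2"
  by (induction q1) (simp_all add: map_poly_pCons map_poly_of_real_add map_poly_smult)

text \<open>
  Induction on the degree: a real root in the resolvent set splits off an invertible linear factor,
  a nonreal root \<open>z\<close> splits off \<open>(A - Re z)\<^sup>2 + (Im z)\<^sup>2\<close>, which is coercive.
\<close>

lemma invertible_poly_op:
  assumes sa: "self_adjoint A"
  shows "q \<noteq> 0 \<Longrightarrow> (\<And>t. t \<in> real_spectrum A \<Longrightarrow> poly q t \<noteq> 0) \<Longrightarrow> invertible_op (poly_op q A)"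
proof (induction "degree q" arbitrary: q rule: less_induct)
  case less
  show ?case
  proof (cases "degree q = 0")
    case True
    then obtain a where "q = [:a:]" by (rule degree_eq_zeroE)
    with less.prems(1) show ?thesis
      by (simp add: poly_op_pCons invertible_op_scaleR)
  next
    case False
    let ?q = "map_poly complex_of_real q"
    have "degree ?q = degree q"
      by (rule degree_map_poly) simp
    with False have "\<not> constant (poly ?q)"
      by (simp add: constant_degree)
    then obtain z where z: "poly ?q z = 0"
      using fundamental_theorem_of_algebra by blast
    \<comment> \<open>Splitting off an invertible factor of positive degree lowers the degree, and
      the roots of the cofactor are roots of \<open>q\<close>, so the induction hypothesis
      applies.\<close>
    have step: "invertible_op (poly_op q A)"
      if q: "q = d * q'" and d: "0 < degree d" "invertible_op (poly_op d A)" for d q'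
    proof -
      have nz: "d \<noteq> 0" "q' \<noteq> 0" using less.prems(1) q by auto
      have "invertible_op (poly_op q' A)"
        using less.prems(2) d nz by (intro less.hyps) (auto simp: q degree_mult_eq)
      with d show ?thesis
        by (simp add: q poly_op_mult invertible_op_mult)
    qed
    show ?thesis
    proof (cases "Im z = 0")
      case True
      then have "z = complex_of_real (Re z)"
        by (simp add: complex_eq_iff)
      with z have "complex_of_real (poly q (Re z)) = 0"
        by (metis poly_map_of_real)
      then have root: "poly q (Re z) = 0" by simp
      then obtain q' where "q = [:- Re z, 1:] * q'"
        using poly_eq_0_iff_dvd by blast
      moreover have "invertible_op (poly_op [:- Re z, 1:] A)"
        using less.prems(2)[of "Re z"] root
        by (auto simp: real_spectrum_iff poly_op_pCons)
      ultimately show ?thesis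
        by (intro step) simp_all
    next
      case False
      \<comment> \<open>The real quadratic \<open>(X - z) (X - cnj z)\<close>.\<close>
      define d where "d = [:(Re z)\<^sup>2 + (Im z)\<^sup>2, - 2 * Re z, 1:]"
      have deg: "degree d = 2" by (simp add: d_def)
      have zd: "poly (map_poly complex_of_real d) z = 0"
        by (simp add: d_def map_poly_pCons complex_eq_iff algebra_simps power2_eq_square)
      \<comment> \<open>The remainder is a real polynomial of degree at most one that vanishes at
        the nonreal \<open>z\<close>, so both its coefficients are zero and \<open>d\<close> divides
        \<open>q\<close>.\<close>
      have "degree (q mod d) < 2"
        using degree_mod_less[of d q] deg by force
      then have "q mod d = [:coeff (q mod d) 0, coeff (q mod d) 1:]"
        by (intro poly_eqI) (auto simp: coeff_pCons coeff_eq_0 split: nat.split)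
      then obtain b c where bc: "q mod d = [:b, c:]" by blast
      have "poly ?q z = poly (map_poly complex_of_real (d * (q div d) + q mod d)) z"
        by simp
      also have "\<dots> = complex_of_real b + complex_of_real c * z"
        unfolding bc map_poly_of_real_add map_poly_of_real_mult
        using zd by (simp add: map_poly_pCons mult.commute)
      finally have "complex_of_real b + complex_of_real c * z = 0"
        using z by simp
      then have "b = 0 \<and> c = 0"
        using False by (auto simp: complex_eq_iff)
      with bc have "q = d * (q div d)"
        by (metis add.right_neutral mult_div_mod_eq pCons_0_0)
      moreover have "invertible_op (poly_op d A)"
      proof (rule invertible_op_coercive)
        fix x
        let ?B = "A - Re z *\<^sub>R 1"
        \<comment> \<open>Completing the square: the form of the square of a self-adjoint operator
          is a squared norm, so \<open>(Im z)^2\<close> is a coercivity constant.\<close>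
        have "poly_op d A = ?B * ?B + (Im z)\<^sup>2 *\<^sub>R 1"
          by (simp add: d_def poly_op_pCons algebra_simps power2_eq_square mult.commute
              flip: scaleR_2)
        moreover have "self_adjoint ?B"
          using sa by (simp add: self_adjoint_diff self_adjoint_scaleR)
        ultimately show "(Im z)\<^sup>2 * (norm x)\<^sup>2 \<le> inner (bop_apply (poly_op d A) x) x"
          by (simp add: bop_apply_simps(1,5,7,8) inner_add_left self_adjointD[of ?B "bop_apply ?B x"]
              power2_norm_eq_inner)
      qed (use False in simp)
      ultimately show ?thesis
        using deg by (intro step) simp_all
    qed
  qed
qed

text \<open>Spectral mapping, in the direction needed below: if \<open>q - m\<close> had no root in
  the spectrum of \<open>A\<close>, then \<open>q(A) - m\<close> would be invertible.\<close>

lemma real_spectrum_poly_op: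
  fixes A :: "'a::complex_hilbert_space bop"
  assumes sa: "self_adjoint A" and m: "m \<in> real_spectrum (poly_op q A)"
    and nontriv: "(x0 :: 'a) \<noteq> 0"
  obtains t where "t \<in> real_spectrum A" "poly q t = m"
proof (cases "q = [:m:]")
  \<comment> \<open>Here \<open>q - [:m:]\<close> is zero and \<open>invertible_poly_op\<close> does
    not apply, but any spectral point will do, and one exists on a nontrivial space.\<close>
  case True
  with that real_spectrum_lower_bound[OF sa nontriv] show ?thesis by auto
next
  case False
  have "\<not> invertible_op (poly_op (q - [:m:]) A)"
    using m by (simp add: real_spectrum_iff poly_op_diff poly_op_pCons)
  with invertible_poly_op[OF sa, of "q - [:m:]"] False that show ?thesis by auto
qed

text \<open>\<open>q(A)\<close> is bounded below by one of its own spectral values, which by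
  spectral mapping is a value of \<open>q\<close> on the spectrum of \<open>A\<close>. On the
  trivial space every operator is zero.\<close>

lemma poly_op_nonneg:
  fixes A :: "'a::complex_hilbert_space bop"
  assumes sa: "self_adjoint A" and nn: "\<And>t. t \<in> real_spectrum A \<Longrightarrow> 0 \<le> poly q t"
  shows "0 \<le> poly_op q A"
proof (cases "\<exists>x::'a. x \<noteq> 0")
  case True
  then obtain x0 :: 'a where x0: "x0 \<noteq> 0" by blast
  have saq: "self_adjoint (poly_op q A)"
    by (rule self_adjoint_poly_op[OF sa])
  obtain m where m: "m \<in> real_spectrum (poly_op q A)" "m *\<^sub>R 1 \<le> poly_op q A"
    by (rule real_spectrum_lower_bound[OF saq x0])
  from real_spectrum_poly_op[OF sa m(1) x0] nn have "0 \<le> m" by blast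
  then have "0 \<le> m *\<^sub>R (1 :: 'a bop)"
    by (simp add: nonneg_bop_iff self_adjoint_scaleR bop_apply_simps)
  then show ?thesis using m(2) by (rule order_trans)
next
  case False
  then have "poly_op q A = 0" by (intro bop_eqI) metis
  then show ?thesis by simp
qed

text \<open>Positivity of \<open>c - q(A)\<close> and \<open>c + q(A)\<close> sandwiches
  \<open>q(A)\<close> between \<open>-c\<close> and \<open>c\<close>.\<close>

lemma norm_poly_op_le:
  assumes sa: "self_adjoint A" and c: "0 \<le> c"
    and le: "\<And>t. t \<in> real_spectrum A \<Longrightarrow> \<bar>poly q t\<bar> \<le> c"
  shows "norm (poly_op q A) \<le> c"
proof (rule norm_self_adjoint_le[OF self_adjoint_poly_op[OF sa] _ _ c])
  have "0 \<le> poly_op ([:c:] - q) A" "0 \<le> poly_op (q + [:c:]) A"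
    using le by (intro poly_op_nonneg[OF sa]; force simp: abs_le_iff)+
  then show "- c *\<^sub>R 1 \<le> poly_op q A" "poly_op q A \<le> c *\<^sub>R 1"
    by (simp_all add: poly_op_diff poly_op_add poly_op_pCons less_eq_bop_def)
qed

section \<open>Continuous functional calculus\<close>

lemma poly_fun_simps:
  "poly (q1 + q2) = (\<lambda>t. poly q1 t + poly q2 t)"
  "poly (q1 - q2) = (\<lambda>t. poly q1 t - poly q2 t)"
  "poly (q1 * q2) = (\<lambda>t. poly q1 t * poly q2 t)"
  "poly (pCons c q) = (\<lambda>t. c + t * poly q t)"
  "poly 0 = (\<lambda>t. 0)"
  for q1 q2 q :: "'a::comm_ring poly"
  by (simp_all add: fun_eq_iff)

text \<open>Stone-Weierstrass with error \<open>1 / (n + 1)\<close>, repackaged as a sequence of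
  formal polynomials.\<close>

lemma real_poly_approximation:
  fixes f :: "real \<Rightarrow> real"
  assumes "continuous_on {a..b} f"
  obtains q where "uniform_limit {a..b} (\<lambda>n. poly (q n)) f sequentially"
proof -
  have "\<exists>q. \<forall>t\<in>{a..b}. \<bar>f t - poly q t\<bar> < inverse (Suc n)" for n
  proof -
    obtain g where g: "real_polynomial_function g"
      "\<And>t. t \<in> {a..b} \<Longrightarrow> \<bar>f t - g t\<bar> < inverse (Suc n)"
      by (rule Stone_Weierstrass_real_polynomial_function[OF compact_Icc assms]) auto
    then obtain c k where "g = (\<lambda>t. \<Sum>i\<le>k. c i * t ^ i)"
      by (auto simp: real_polynomial_function_iff_sum)
    with g(2) show ?thesis
      by (intro exI[of _ "\<Sum>i\<le>k. monom (c i) i"]) (simp add: poly_sum poly_monom)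
  qed
  then obtain q where q: "\<And>n t. t \<in> {a..b} \<Longrightarrow> \<bar>f t - poly (q n) t\<bar> < inverse (Suc n)"
    by metis
  have "uniform_limit {a..b} (\<lambda>n. poly (q n)) f sequentially"
  proof (rule uniform_limitI)
    fix e :: real assume "0 < e"
    then have "\<forall>\<^sub>F n in sequentially. inverse (real (Suc n)) < e"
      by (rule order_tendstoD(2)[OF LIMSEQ_inverse_real_of_nat])
    then show "\<forall>\<^sub>F n in sequentially. \<forall>t\<in>{a..b}. dist (poly (q n) t) (f t) < e"
    proof eventually_elim
      case (elim n)
      show ?case
      proof
        fix t assume "t \<in> {a..b}"
        from q[OF this, of n] elim show "dist (poly (q n) t) (f t) < e"
          by (simp add: dist_real_def abs_minus_commute)
      qed
    qed
  qed
  then show ?thesis by (rule that)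
qed

lemma poly_op_tendsto_0:
  assumes sa: "self_adjoint A"
    and lim: "uniform_limit (real_spectrum A) (\<lambda>n. poly (q n)) (\<lambda>t. 0) sequentially"
  shows "(\<lambda>n. poly_op (q n) A) \<longlonglongrightarrow> 0"
proof (rule tendstoI)
  fix e :: real assume "0 < e"
  then have "\<forall>\<^sub>F n in sequentially. \<forall>t\<in>real_spectrum A. dist (poly (q n) t) 0 < e / 2"
    by (intro uniform_limitD[OF lim]) simp
  then show "\<forall>\<^sub>F n in sequentially. dist (poly_op (q n) A) 0 < e"
  proof eventually_elim
    case (elim n)
    then have "norm (poly_op (q n) A) \<le> e / 2"
      using \<open>0 < e\<close> by (intro norm_poly_op_le[OF sa]) (auto intro: less_imp_le)
    with \<open>0 < e\<close> show ?case by simp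
  qed
qed

lemma poly_op_Cauchy:
  assumes sa: "self_adjoint A"
    and lim: "uniform_limit (real_spectrum A) (\<lambda>n. poly (q n)) f sequentially"
  shows "Cauchy (\<lambda>n. poly_op (q n) A)"
proof (rule metric_CauchyI)
  fix e :: real assume "0 < e"
  \<comment> \<open>Two errors below \<open>e / 4\<close> add up to at most \<open>e / 2\<close>,
    which leaves room because the norm estimate is not strict.\<close>
  then have "\<forall>\<^sub>F n in sequentially. \<forall>t\<in>real_spectrum A. dist (poly (q n) t) (f t) < e / 4"
    by (intro uniform_limitD[OF lim]) simp
  then obtain N where N: "\<And>n t. N \<le> n \<Longrightarrow> t \<in> real_spectrum A \<Longrightarrow> dist (poly (q n) t) (f t) < e / 4"
    by (auto simp: eventually_sequentially)
  have "dist (poly_op (q m) A) (poly_op (q n) A) < e" if "N \<le> m" "N \<le> n" for m n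
  proof -
    have "norm (poly_op (q m - q n) A) \<le> e / 2"
    proof (rule norm_poly_op_le[OF sa])
      show "\<bar>poly (q m - q n) t\<bar> \<le> e / 2" if "t \<in> real_spectrum A" for t
        using N[OF \<open>N \<le> m\<close> that] N[OF \<open>N \<le> n\<close> that] unfolding dist_real_def poly_diff by linarith
    qed (use \<open>0 < e\<close> in simp)
    with \<open>0 < e\<close> show ?thesis by (simp add: dist_norm poly_op_diff)
  qed
  then show "\<exists>M. \<forall>m\<ge>M. \<forall>n\<ge>M. dist (poly_op (q m) A) (poly_op (q n) A) < e"
    by blast
qed

text \<open>Functions are taken continuous on an interval around the spectrum, so that Weierstrass
  approximation applies to them without an extension argument.\<close>

definition calc_on :: "real \<Rightarrow> real \<Rightarrow> 'a::complex_hilbert_space bop \<Rightarrow> bool" where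
  "calc_on a b A \<longleftrightarrow> self_adjoint A \<and> real_spectrum A \<subseteq> {a..b}"

text \<open>Two approximating sequences differ by polynomials tending uniformly to zero on the
  spectrum, so all of them give the same operator limit, which is what the description in
  \<open>fun_calc\<close> asks for.\<close>

lemma fun_calc_limit:
  assumes A: "calc_on a b A" and f: "continuous_on {a..b} f"
    and lim: "uniform_limit (real_spectrum A) (\<lambda>n. poly (q n)) f sequentially"
  shows "(\<lambda>n. poly_op (q n) A) \<longlonglongrightarrow> fun_calc f A"
proof -
  have sa: "self_adjoint A" and sub: "real_spectrum A \<subseteq> {a..b}"
    using A by (auto simp: calc_on_def)
  let ?P = "\<lambda>T. \<forall>q :: nat \<Rightarrow> real poly.
    uniform_limit (real_spectrum A) (\<lambda>n. poly (q n)) f sequentially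
      \<longrightarrow> (\<lambda>n. poly_op (q n) A) \<longlonglongrightarrow> T"
  obtain T where T: "(\<lambda>n. poly_op (q n) A) \<longlonglongrightarrow> T"
    using poly_op_Cauchy[OF sa lim] Cauchy_convergent_iff convergent_def by blast
  have "?P T"
  proof (intro allI impI)
    fix q' :: "nat \<Rightarrow> real poly"
    assume lim': "uniform_limit (real_spectrum A) (\<lambda>n. poly (q' n)) f sequentially"
    have "(\<lambda>n. poly_op (q' n - q n) A) \<longlonglongrightarrow> 0"
      using uniform_limit_minus[OF lim' lim] by (intro poly_op_tendsto_0[OF sa]) (simp add: poly_fun_simps)
    from tendsto_add[OF this T] show "(\<lambda>n. poly_op (q' n) A) \<longlonglongrightarrow> T"
      by (simp add: poly_op_diff)
  qed
  \<comment> \<open>The given sequence \<open>q\<close> is itself approximating, so the defining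
    condition is not vacuous and determines the limit.\<close>
  moreover have "S = T" if "?P S" for S
    using that lim T LIMSEQ_unique by blast
  ultimately have "fun_calc f A = T"
    unfolding fun_calc_def real_spectrum_def[symmetric] by (intro the_equality) blast+
  with T show ?thesis by simp
qed

lemma fun_calc_limit_Icc:
  assumes A: "calc_on a b A" and f: "continuous_on {a..b} f"
    and lim: "uniform_limit {a..b} (\<lambda>n. poly (q n)) f sequentially"
  shows "(\<lambda>n. poly_op (q n) A) \<longlonglongrightarrow> fun_calc f A"
  using A by (intro fun_calc_limit[OF A f] uniform_limit_on_subset[OF lim]) (simp add: calc_on_def)

lemma fun_calc_poly:
  assumes "calc_on a b A"
  shows "fun_calc (poly q) A = poly_op q A"
proof (rule LIMSEQ_unique)
  show "(\<lambda>_. poly_op q A) \<longlonglongrightarrow> fun_calc (poly q) A"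
    by (rule fun_calc_limit_Icc[OF assms]) (simp_all add: continuous_on_poly uniform_limit_const)
qed (rule tendsto_const)

lemma fun_calc_cong:
  assumes A: "calc_on a b A" and "\<And>t. t \<in> {a..b} \<Longrightarrow> f t = g t"
  shows "fun_calc f A = fun_calc g A"
proof -
  have "f t = g t" if "complex_of_real t \<in> op_spectrum A" for t
    using assms that by (auto simp: calc_on_def real_spectrum_def)
  then have "uniform_limit {t. complex_of_real t \<in> op_spectrum A} (\<lambda>n. poly (q n)) f sequentially
      \<longleftrightarrow> uniform_limit {t. complex_of_real t \<in> op_spectrum A} (\<lambda>n. poly (q n)) g sequentially" for q
    by (intro uniform_limit_cong') auto
  then show ?thesis
    by (simp add: fun_calc_def)
qed

section \<open>Algebraic rules and monotonicity of the functional calculus\<close>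

lemma fun_calc_add:
  assumes A: "calc_on a b A" and f: "continuous_on {a..b} f" and g: "continuous_on {a..b} g"
  shows "fun_calc (\<lambda>t. f t + g t) A = fun_calc f A + fun_calc g A"
proof -
  obtain q q' where q: "uniform_limit {a..b} (\<lambda>n. poly (q n)) f sequentially"
    and q': "uniform_limit {a..b} (\<lambda>n. poly (q' n)) g sequentially"
    using real_poly_approximation f g by metis
  have "(\<lambda>n. poly_op (q n + q' n) A) \<longlonglongrightarrow> fun_calc (\<lambda>t. f t + g t) A"
    using uniform_limit_add[OF q q'] f g
    by (intro fun_calc_limit_Icc[OF A] continuous_intros) (simp_all add: poly_fun_simps)
  moreover have "(\<lambda>n. poly_op (q n + q' n) A) \<longlonglongrightarrow> fun_calc f A + fun_calc g A"
    unfolding poly_op_add by (intro tendsto_add fun_calc_limit_Icc[OF A] f g q q')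
  ultimately show ?thesis by (rule LIMSEQ_unique)
qed

lemma fun_calc_mult:
  assumes A: "calc_on a b A" and f: "continuous_on {a..b} f" and g: "continuous_on {a..b} g"
  shows "fun_calc (\<lambda>t. f t * g t) A = fun_calc f A * fun_calc g A"
proof -
  obtain q q' where q: "uniform_limit {a..b} (\<lambda>n. poly (q n)) f sequentially"
    and q': "uniform_limit {a..b} (\<lambda>n. poly (q' n)) g sequentially"
    using real_poly_approximation f g by metis
  \<comment> \<open>The product rule for uniform limits is applied with bounded limit functions;
    boundedness comes from compactness of the interval.\<close>
  have "bounded (f ` {a..b})" "bounded (g ` {a..b})"
    using f g by (auto intro!: compact_imp_bounded compact_continuous_image)
  then have "(\<lambda>n. poly_op (q n * q' n) A) \<longlonglongrightarrow> fun_calc (\<lambda>t. f t * g t) A"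
    using uniform_lim_mult[OF q q'] f g
    by (intro fun_calc_limit_Icc[OF A] continuous_intros) (simp_all add: poly_fun_simps)
  moreover have "(\<lambda>n. poly_op (q n * q' n) A) \<longlonglongrightarrow> fun_calc f A * fun_calc g A"
    unfolding poly_op_mult by (intro tendsto_mult fun_calc_limit_Icc[OF A] f g q q')
  ultimately show ?thesis by (rule LIMSEQ_unique)
qed

lemma fun_calc_const: "calc_on a b A \<Longrightarrow> fun_calc (\<lambda>t. c) A = c *\<^sub>R 1"
  using fun_calc_poly[of a b A "[:c:]"] by (simp add: poly_op_pCons poly_fun_simps)

lemma fun_calc_id: "calc_on a b A \<Longrightarrow> fun_calc (\<lambda>t. t) A = A"
  using fun_calc_poly[of a b A "[:0, 1:]"] by (simp add: poly_op_pCons poly_fun_simps)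

lemma fun_calc_scaleR:
  assumes A: "calc_on a b A" and f: "continuous_on {a..b} f"
  shows "fun_calc (\<lambda>t. c * f t) A = c *\<^sub>R fun_calc f A"
  using fun_calc_mult[OF A continuous_on_const f] by (simp add: fun_calc_const[OF A])

lemma fun_calc_diff:
  assumes A: "calc_on a b A" and f: "continuous_on {a..b} f" and g: "continuous_on {a..b} g"
  shows "fun_calc (\<lambda>t. f t - g t) A = fun_calc f A - fun_calc g A"
  using fun_calc_add[OF A f, of "\<lambda>t. - 1 * g t"] fun_calc_scaleR[OF A g, of "- 1"] g
  by (simp add: continuous_on_minus)

text \<open>If polynomials \<open>q n\<close> approximate the square root of \<open>f\<close>, then
  \<open>f(A)\<close> is the limit of the squares of \<open>poly_op (q n) A\<close>, which are
  positive.\<close>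

lemma fun_calc_nonneg:
  assumes A: "calc_on a b A" and f: "continuous_on {a..b} f"
    and nn: "\<And>t. t \<in> {a..b} \<Longrightarrow> 0 \<le> f t"
  shows "0 \<le> fun_calc f A"
proof -
  let ?g = "\<lambda>t. sqrt (f t)"
  have g: "continuous_on {a..b} ?g"
    using f by (intro continuous_intros)
  obtain q where q: "uniform_limit {a..b} (\<lambda>n. poly (q n)) ?g sequentially"
    using real_poly_approximation[OF g] by metis
  have lim: "(\<lambda>n. poly_op (q n) A) \<longlonglongrightarrow> fun_calc ?g A"
    by (rule fun_calc_limit_Icc[OF A g q])
  have "fun_calc f A = fun_calc (\<lambda>t. ?g t * ?g t) A"
    using nn by (intro fun_calc_cong[OF A]) simp
  also have "\<dots> = fun_calc ?g A * fun_calc ?g A"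
    by (rule fun_calc_mult[OF A g g])
  finally have "(\<lambda>n. poly_op (q n) A * poly_op (q n) A) \<longlonglongrightarrow> fun_calc f A"
    using tendsto_mult[OF lim lim] by simp
  moreover have "0 \<le> poly_op (q n) A * poly_op (q n) A" for n
    unfolding poly_op_mult[symmetric] using A by (intro poly_op_nonneg) (simp_all add: calc_on_def)
  ultimately show ?thesis by (rule nonneg_bop_limit)
qed

lemma fun_calc_mono:
  assumes A: "calc_on a b A" and f: "continuous_on {a..b} f" and g: "continuous_on {a..b} g"
    and le: "\<And>t. t \<in> {a..b} \<Longrightarrow> f t \<le> g t"
  shows "fun_calc f A \<le> fun_calc g A"
proof -
  have "0 \<le> fun_calc (\<lambda>t. g t - f t) A"
    using f g le by (intro fun_calc_nonneg[OF A] continuous_intros) auto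
  then show ?thesis by (simp add: fun_calc_diff[OF A g f])
qed

section \<open>Real powers of positive invertible operators\<close>

lemma nonneg_invertible_calc_on:
  assumes "0 \<le> A" "invertible_op A"
  obtains a b where "0 < a" "calc_on a b A"
proof -
  obtain c where c: "0 < c" "c *\<^sub>R 1 \<le> A"
    using nonneg_invertible_coercive[OF assms] .
  have sa: "self_adjoint A"
    using assms by (simp add: nonneg_bop_iff)
  show ?thesis
    using c real_spectrum_subset[OF c(2) bop_le_norm(1)[OF sa]] sa
    by (intro that[of c "norm A"]) (simp_all add: calc_on_def)
qed

text \<open>The interval stays away from 0, so negative exponents such as \<open>-1/2\<close> are
  covered.\<close>

lemma continuous_on_powr_Icc: "0 < a \<Longrightarrow> continuous_on {a..b} (\<lambda>t. t powr p)" for a b p :: real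
  by (intro continuous_intros) auto

lemma op_powr_add:
  assumes "0 \<le> A" "invertible_op A"
  shows "op_powr A p * op_powr A q = op_powr A (p + q)"
proof -
  obtain a b where ab: "0 < a" "calc_on a b A"
    using nonneg_invertible_calc_on[OF assms] .
  show ?thesis
    unfolding op_powr_def powr_add
    by (rule fun_calc_mult[symmetric, OF ab(2)]) (use ab in \<open>simp_all add: continuous_on_powr_Icc\<close>)
qed

lemma op_powr_0:
  assumes "0 \<le> A" "invertible_op A"
  shows "op_powr A 0 = 1"
proof -
  obtain a b where ab: "0 < a" "calc_on a b A"
    using nonneg_invertible_calc_on[OF assms] .
  \<comment> \<open>Here \<open>0 < a\<close> matters: \<open>0 powr 0\<close> is 0, not 1.\<close>
  have "op_powr A 0 = fun_calc (\<lambda>t. 1) A"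
    unfolding op_powr_def by (rule fun_calc_cong[OF ab(2)]) (use ab in auto)
  then show ?thesis by (simp add: fun_calc_const[OF ab(2)])
qed

lemma op_powr_1:
  assumes "0 \<le> A" "invertible_op A"
  shows "op_powr A 1 = A"
proof -
  obtain a b where ab: "0 < a" "calc_on a b A"
    using nonneg_invertible_calc_on[OF assms] .
  have "op_powr A 1 = fun_calc (\<lambda>t. t) A"
    unfolding op_powr_def by (rule fun_calc_cong[OF ab(2)]) (use ab in auto)
  then show ?thesis by (simp add: fun_calc_id[OF ab(2)])
qed

lemma op_powr_nonneg:
  assumes "0 \<le> A" "invertible_op A"
  shows "0 \<le> op_powr A p"
proof -
  obtain a b where ab: "0 < a" "calc_on a b A"
    using nonneg_invertible_calc_on[OF assms] .
  show ?thesis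
    unfolding op_powr_def
    by (rule fun_calc_nonneg[OF ab(2)]) (use ab in \<open>simp_all add: continuous_on_powr_Icc\<close>)
qed

section \<open>The refined Young inequality and its reverse\<close>

text \<open>After cancelling the refinement term, what remains is the weighted Young inequality for
  \<open>sqrt t\<close> and the nearer endpoint: 1 with weight \<open>1 - 2*p\<close>, or
  \<open>t\<close> with weight \<open>2*p - 1\<close>.\<close>

lemma Young_refined:
  fixes p t :: real
  assumes "0 \<le> p" "p \<le> 1" "0 < t"
  shows "min p (1 - p) * (1 + t - 2 * t powr (1/2)) + t powr p \<le> (1 - p) + p * t"
proof (cases "p \<le> 1/2")
  case True
  have "1 powr (1 - 2*p) * (t powr (1/2)) powr (2*p) \<le> (1 - 2*p) * 1 + 2*p * t powr (1/2)"
    using assms True by (intro Youngs_inequality_0) auto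
  then have "t powr p \<le> 1 - 2*p + 2*p * t powr (1/2)"
    by (simp add: powr_powr)
  with True show ?thesis by (simp add: min_def algebra_simps)
next
  case False
  have "t powr (2*p - 1) * (t powr (1/2)) powr (2 - 2*p) \<le> (2*p - 1) * t + (2 - 2*p) * t powr (1/2)"
    using assms False by (intro Youngs_inequality_0) auto
  moreover have "t powr (2*p - 1) * (t powr (1/2)) powr (2 - 2*p) = t powr p"
    by (simp add: powr_powr field_simps flip: powr_add)
  ultimately have "t powr p \<le> (2*p - 1) * t + (2 - 2*p) * t powr (1/2)"
    by simp
  with False show ?thesis by (simp add: min_def algebra_simps)
qed

text \<open>Here \<open>sqrt t\<close> is the geometric mean: Young's inequality is applied to
  \<open>t powr p\<close> and the farther endpoint, \<open>t\<close> for \<open>p \<le> 1/2\<close>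
  and 1 otherwise.\<close>

lemma Young_reverse:
  fixes p t :: real
  assumes "0 \<le> p" "p \<le> 1" "0 < t"
  shows "(1 - p) + p * t \<le> max p (1 - p) * (1 + t - 2 * t powr (1/2)) + t powr p"
proof (cases "p \<le> 1/2")
  case True
  \<comment> \<open>The weight solves \<open>(1 - w) + p * w = 1/2\<close>, so the weighted
    geometric mean of \<open>t\<close> and \<open>t powr p\<close> is \<open>sqrt t\<close>.\<close>
  define w where "w = 1 / (2 - 2*p)"
  have w: "w * (2 - 2*p) = 1" "0 < w"
    using True by (simp_all add: w_def)
  have "t powr (1 - w) * (t powr p) powr w \<le> (1 - w) * t + w * t powr p"
    using assms True w(2) by (intro Youngs_inequality_0) (auto simp: w_def divide_simps)
  moreover have "(1 - w) + p * w = 1/2"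
    using w by (simp add: algebra_simps)
  then have "t powr (1 - w) * (t powr p) powr w = t powr (1/2)"
    by (simp only: powr_powr powr_add[symmetric])
  ultimately have "(2 - 2*p) * t powr (1/2) \<le> (2 - 2*p) * ((1 - w) * t + w * t powr p)"
    using True by (intro mult_left_mono) auto
  also have "\<dots> = (2 - 2*p) * t + (w * (2 - 2*p)) * (t powr p - t)"
    by (simp add: algebra_simps)
  finally show ?thesis using True unfolding w(1) by (simp add: max_def algebra_simps)
next
  case False
  \<comment> \<open>The weight solves \<open>p * w = 1/2\<close>, so the weighted geometric mean of
    1 and \<open>t powr p\<close> is \<open>sqrt t\<close>.\<close>
  define w where "w = 1 / (2*p)"
  have w: "w * (2*p) = 1" "0 < w"
    using False by (simp_all add: w_def)
  have "1 powr (1 - w) * (t powr p) powr w \<le> (1 - w) * 1 + w * t powr p"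
    using assms False w(2) by (intro Youngs_inequality_0) (auto simp: w_def divide_simps)
  moreover have "p * w = 1/2"
    using w by (simp add: algebra_simps)
  then have "(t powr p) powr w = t powr (1/2)"
    by (simp only: powr_powr)
  ultimately have "(2*p) * t powr (1/2) \<le> (2*p) * ((1 - w) + w * t powr p)"
    using False by (intro mult_left_mono) auto
  also have "\<dots> = 2*p + (w * (2*p)) * (t powr p - 1)"
    by (simp add: algebra_simps)
  finally show ?thesis using False unfolding w(1) by (simp add: max_def algebra_simps)
qed

section \<open>From scalar inequalities to operators and their means\<close>

lemma op_powr_Young:
  assumes X: "0 \<le> X" "invertible_op X" and p: "0 \<le> p" "p \<le> 1"
  shows "min p (1 - p) *\<^sub>R (1 + X - 2 *\<^sub>R op_powr X (1/2)) + op_powr X p \<le> (1 - p) *\<^sub>R 1 + p *\<^sub>R X"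
    and "(1 - p) *\<^sub>R 1 + p *\<^sub>R X \<le> max p (1 - p) *\<^sub>R (1 + X - 2 *\<^sub>R op_powr X (1/2)) + op_powr X p"
proof -
  obtain a b where ab: "0 < a" and X': "calc_on a b X"
    using nonneg_invertible_calc_on[OF X] .
  have cont: "continuous_on {a..b} (\<lambda>t. t powr s)" for s
    using ab by (rule continuous_on_powr_Icc)
  note calc = fun_calc_add[OF X'] fun_calc_diff[OF X'] fun_calc_scaleR[OF X'] fun_calc_const[OF X'] fun_calc_id[OF X']
  have lin: "fun_calc (\<lambda>t. (1 - p) + p * t) X = (1 - p) *\<^sub>R 1 + p *\<^sub>R X"
    by (simp add: calc continuous_intros)
  have pow: "fun_calc (\<lambda>t. r * (1 + t - 2 * t powr (1/2)) + t powr p) X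
      = r *\<^sub>R (1 + X - 2 *\<^sub>R op_powr X (1/2)) + op_powr X p" for r
    by (simp add: calc continuous_intros cont op_powr_def)
  show "min p (1 - p) *\<^sub>R (1 + X - 2 *\<^sub>R op_powr X (1/2)) + op_powr X p \<le> (1 - p) *\<^sub>R 1 + p *\<^sub>R X"
    unfolding lin[symmetric] pow[symmetric] using Young_refined[OF p] ab
    by (intro fun_calc_mono[OF X'] continuous_intros cont) auto
  show "(1 - p) *\<^sub>R 1 + p *\<^sub>R X \<le> max p (1 - p) *\<^sub>R (1 + X - 2 *\<^sub>R op_powr X (1/2)) + op_powr X p"
    unfolding lin[symmetric] pow[symmetric] using Young_reverse[OF p] ab
    by (intro fun_calc_mono[OF X'] continuous_intros cont) auto
qed

lemma geo_mean_Young: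
  assumes A: "0 \<le> A" "invertible_op A" and B: "0 \<le> B" "invertible_op B" and p: "0 \<le> p" "p \<le> 1"
  shows "(2 * min p (1 - p)) *\<^sub>R (arith_mean (1/2) A B - geo_mean (1/2) A B) + geo_mean p A B
      \<le> arith_mean p A B"
    and "arith_mean p A B
      \<le> (2 * max p (1 - p)) *\<^sub>R (arith_mean (1/2) A B - geo_mean (1/2) A B) + geo_mean p A B"
proof -
  define G where "G = op_powr A (1/2)"
  define H where "H = op_powr A (-1/2)"
  define X where "X = H * B * H"
  have GH: "G * H = 1" "H * G = 1" and GG: "G * G = A"
    using A by (simp_all add: G_def H_def op_powr_add op_powr_0 op_powr_1)
  have sa: "self_adjoint G" "self_adjoint H"
    using op_powr_nonneg[OF A] by (auto simp: G_def H_def nonneg_bop_iff)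
  have GXG: "G * (X * G) = B"
    using GH by (metis X_def mult.assoc mult_1_left mult_1_right)
  have "invertible_op H"
    using GH by (auto simp: invertible_op_def)
  with B sa have X: "0 \<le> X" "invertible_op X"
    by (simp_all add: X_def nonneg_conj invertible_op_mult)
  have geo: "geo_mean s A B = G * op_powr X s * G" for s
    by (simp add: geo_mean_def G_def H_def X_def)
  have lin: "G * ((1 - p) *\<^sub>R 1 + p *\<^sub>R X) * G = arith_mean p A B"
    by (simp add: arith_mean_def distrib_left distrib_right GG GXG mult.assoc)
  \<comment> \<open>Conjugation by \<open>G\<close> turns \<open>1 + X - 2 X^(1/2)\<close> into
    \<open>A + B - 2 (A # B)\<close>, twice the difference of the two means; hence the factor
    \<open>2 * r\<close>.\<close>
  have pow: "G * (r *\<^sub>R (1 + X - 2 *\<^sub>R op_powr X (1/2)) + op_powr X p) * G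
      = (2 * r) *\<^sub>R (arith_mean (1/2) A B - geo_mean (1/2) A B) + geo_mean p A B" for r
    by (simp add: arith_mean_def geo algebra_simps GG GXG)
  show "(2 * min p (1 - p)) *\<^sub>R (arith_mean (1/2) A B - geo_mean (1/2) A B) + geo_mean p A B
      \<le> arith_mean p A B"
    unfolding lin[symmetric] pow[symmetric] by (intro conj_mono sa op_powr_Young X p)
  show "arith_mean p A B
      \<le> (2 * max p (1 - p)) *\<^sub>R (arith_mean (1/2) A B - geo_mean (1/2) A B) + geo_mean p A B"
    unfolding lin[symmetric] pow[symmetric] by (intro conj_mono sa op_powr_Young X p)
qed

theorem theorem3:
  fixes A B :: "'a::complex_hilbert_space bop"
    and \<Phi> :: "'a bop \<Rightarrow> 'a bop"
    and p r R :: real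
  assumes "0 \<le> A" and "invertible_op A"
    and "0 \<le> B" and "invertible_op B"
    and "clinear \<Phi>" and "positive_map \<Phi>" and "\<Phi> 1 = 1"
    and "0 < p" and "p \<le> 1"
    and "r = min p (1 - p)" and "R = max p (1 - p)"
  shows "(2 * r / p) *\<^sub>R (\<Phi> (arith_mean (1/2) A B) - geo_mean (1/2) (\<Phi> A) (\<Phi> B))
           + tsallis p (\<Phi> A) (\<Phi> B) \<le> \<Phi> (B - A)
       \<and> \<Phi> (B - A) \<le> (2 * R / p) *\<^sub>R (\<Phi> (arith_mean (1/2) A B) - \<Phi> (geo_mean (1/2) A B))
           + \<Phi> (tsallis p A B)"
proof -
  note A = assms(1,2) and B = assms(3,4) and \<Phi>1 = assms(7) and p = assms(8,9)
  have add: "\<Phi> (S + T) = \<Phi> S + \<Phi> T" for S T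
    using assms(5) by (simp add: clinear_def)
  have sc: "\<Phi> (c *\<^sub>R S) = c *\<^sub>R \<Phi> S" for c S
    using assms(5) by (simp add: clinear_def scaleR_scaleC)
  have diff: "\<Phi> (S - T) = \<Phi> S - \<Phi> T" for S T
    using add[of "S - T" T] by simp
  have mono: "\<Phi> S \<le> \<Phi> T" if "S \<le> T" for S T
    using assms(6) that diff[of T S] by (metis diff_ge_0_iff_ge positive_map_def)
  \<comment> \<open>A positive lower bound \<open>c\<close> of \<open>S\<close> is also one of
    \<open>\<Phi> S\<close> since \<open>\<Phi>\<close> is monotone and fixes 1; so the mean
    inequality applies to the images.\<close>
  have pos_inv: "0 \<le> \<Phi> S \<and> invertible_op (\<Phi> S)" if S: "0 \<le> S" "invertible_op S" for S
  proof -
    obtain c where c: "0 < c" "c *\<^sub>R 1 \<le> S"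
      using nonneg_invertible_coercive[OF S] .
    then have "invertible_op (\<Phi> S)"
      using mono[OF c(2)] by (intro invertible_op_scaleR_one_le[of c]) (simp_all add: sc \<Phi>1)
    with S assms(6) show ?thesis by (simp add: positive_map_def)
  qed
  have arith: "\<Phi> (arith_mean s A B) = arith_mean s (\<Phi> A) (\<Phi> B)" for s
    by (simp add: arith_mean_def add sc)
  \<comment> \<open>The middle term of the theorem is the weighted arithmetic mean, shifted by
    \<open>\<Phi> A\<close> and scaled by \<open>1 / p\<close>.\<close>
  have diff_eq: "\<Phi> (B - A) = (1 / p) *\<^sub>R (arith_mean p (\<Phi> A) (\<Phi> B) - \<Phi> A)"
    using p by (simp add: arith_mean_def diff scaleR_diff_left scaleR_add_right scaleR_diff_right)
  \<comment> \<open>Both outer terms share the shape on the left; extracting \<open>1 / p\<close>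
    lets each bound follow from the mean inequality by shifting and positive scaling.\<close>
  have comb: "(2 * s / p) *\<^sub>R (S - T) + (1 / p) *\<^sub>R (U - V)
      = (1 / p) *\<^sub>R ((2 * s) *\<^sub>R (S - T) + U - V)" for s and S T U V :: "'a bop"
    by (simp add: scaleR_add_right scaleR_diff_right)
  have "(2 * r) *\<^sub>R (arith_mean (1/2) (\<Phi> A) (\<Phi> B) - geo_mean (1/2) (\<Phi> A) (\<Phi> B))
      + geo_mean p (\<Phi> A) (\<Phi> B) \<le> arith_mean p (\<Phi> A) (\<Phi> B)"
    unfolding assms(10) using pos_inv[OF A] pos_inv[OF B] p by (intro geo_mean_Young) auto
  then have lower: "(2 * r / p) *\<^sub>R (\<Phi> (arith_mean (1/2) A B) - geo_mean (1/2) (\<Phi> A) (\<Phi> B))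
      + tsallis p (\<Phi> A) (\<Phi> B) \<le> \<Phi> (B - A)"
    unfolding arith tsallis_def comb diff_eq using p by (intro scaleR_mono_bop diff_right_mono) auto
  have "\<Phi> (arith_mean p A B)
      \<le> \<Phi> ((2 * R) *\<^sub>R (arith_mean (1/2) A B - geo_mean (1/2) A B) + geo_mean p A B)"
    unfolding assms(11) using A B p by (intro mono geo_mean_Young) auto
  then have "arith_mean p (\<Phi> A) (\<Phi> B)
      \<le> (2 * R) *\<^sub>R (\<Phi> (arith_mean (1/2) A B) - \<Phi> (geo_mean (1/2) A B)) + \<Phi> (geo_mean p A B)"
    by (simp only: arith[of p] add sc diff)
  then have upper: "\<Phi> (B - A) \<le> (2 * R / p) *\<^sub>R (\<Phi> (arith_mean (1/2) A B) - \<Phi> (geo_mean (1/2) A B))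
      + \<Phi> (tsallis p A B)"
    unfolding tsallis_def sc diff[of "geo_mean p A B"] comb diff_eq
    using p by (intro scaleR_mono_bop diff_right_mono) auto
  from lower upper show ?thesis ..
qed

end
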